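(* For every integer $k\geq 0$ there exists a connected non-bipartite König-Egerváry graph $H_k$ of order $2k+9$ such that: (1) $h(H_k)>\left\lceil\frac{n(H_k)}{2}\right\rceil=\alpha(H_k)$; (2) each $S\in\Omega(H_k)$ is a maximal annihilating set.
   Context: Graphs are finite, undirected, without loops or multiple edges. $n(G)=|V(G)|$ is the order and $m(G)=|E(G)|$. $\alpha(G)$ is the maximum size of an independent set, $\mu(G)$ the maximum size of a matching, and $\Omega(G)$ the family of all independent sets of size $\alpha(G)$. $G$ is a König-Egerváry graph if $\alpha(G)+\mu(G)=|V(G)|$. If $d_1\leq d_2\leq\cdots\leq d_n$ is the degree sequence of $G$, the annihilation number $h(G)$ is the largest integer $k$ (with $0\le k\le n$) such that $\sum_{i=1}^{k} d_i\leq m(G)$. For $A\subseteq V(G)$ let $\deg(A)=\sum_{v\in A}\deg(v)$. A set $A\subseteq V(G)$ is an annihilating set if $\deg(A)\leq m(G)$; an annihilating set $A$ is maximal if $\deg(A\cup\{v\})>m(G)$ for every $v\in V(G)-A$. *)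

theory Defs
  imports Complex_Main "HOL-Library.Multiset" "HOL-Library.Disjoint_Sets"
begin

text \<open>
  A graph is given by its vertex set \<open>V\<close> and its set \<open>E\<close> of edges, each edge being the
  two-element set of its end vertices; this excludes loops and multiple edges.
\<close>

definition simple_graph :: "'a set \<Rightarrow> 'a set set \<Rightarrow> bool" where
  "simple_graph V E \<longleftrightarrow> finite V \<and> (\<forall>e\<in>E. e \<subseteq> V \<and> card e = 2)"

definition adj_rel :: "'a set set \<Rightarrow> 'a rel" where
  "adj_rel E = {(u, v). {u, v} \<in> E}"

definition connected_graph :: "'a set \<Rightarrow> 'a set set \<Rightarrow> bool" where
  "connected_graph V E \<longleftrightarrow> V \<noteq> {} \<and> (\<forall>u\<in>V. \<forall>v\<in>V. (u, v) \<in> (adj_rel E)\<^sup>*)"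

definition bipartite_graph :: "'a set \<Rightarrow> 'a set set \<Rightarrow> bool" where
  "bipartite_graph V E \<longleftrightarrow>
    (\<exists>X Y. X \<union> Y = V \<and> X \<inter> Y = {} \<and> (\<forall>e\<in>E. \<exists>x\<in>X. \<exists>y\<in>Y. e = {x, y}))"

definition independent_set :: "'a set \<Rightarrow> 'a set set \<Rightarrow> 'a set \<Rightarrow> bool" where
  "independent_set V E S \<longleftrightarrow> S \<subseteq> V \<and> (\<forall>u\<in>S. \<forall>v\<in>S. {u, v} \<notin> E)"

definition independence_number :: "'a set \<Rightarrow> 'a set set \<Rightarrow> nat" where
  "independence_number V E = Max {card S | S. independent_set V E S}"

definition max_independent_sets :: "'a set \<Rightarrow> 'a set set \<Rightarrow> 'a set set" where
  "max_independent_sets V E =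
    {S. independent_set V E S \<and> card S = independence_number V E}"

definition matching :: "'a set set \<Rightarrow> 'a set set \<Rightarrow> bool" where
  "matching E M \<longleftrightarrow> M \<subseteq> E \<and> disjoint M"

definition matching_number :: "'a set set \<Rightarrow> nat" where
  "matching_number E = Max {card M | M. matching E M}"

definition konig_egervary :: "'a set \<Rightarrow> 'a set set \<Rightarrow> bool" where
  "konig_egervary V E \<longleftrightarrow> independence_number V E + matching_number E = card V"

definition degree :: "'a set set \<Rightarrow> 'a \<Rightarrow> nat" where
  "degree E v = card {e \<in> E. v \<in> e}"

definition degree_sequence :: "'a set \<Rightarrow> 'a set set \<Rightarrow> nat list" where
  "degree_sequence V E = sorted_list_of_multiset (image_mset (degree E) (mset_set V))"

definition annihilation_number :: "'a set \<Rightarrow> 'a set set \<Rightarrow> nat" where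
  "annihilation_number V E =
    Max {k. k \<le> card V \<and> sum_list (take k (degree_sequence V E)) \<le> card E}"

definition set_degree :: "'a set set \<Rightarrow> 'a set \<Rightarrow> nat" where
  "set_degree E A = (\<Sum>v\<in>A. degree E v)"

definition annihilating_set :: "'a set \<Rightarrow> 'a set set \<Rightarrow> 'a set \<Rightarrow> bool" where
  "annihilating_set V E A \<longleftrightarrow> A \<subseteq> V \<and> set_degree E A \<le> card E"

definition maximal_annihilating_set :: "'a set \<Rightarrow> 'a set set \<Rightarrow> 'a set \<Rightarrow> bool" where
  "maximal_annihilating_set V E A \<longleftrightarrow>
    annihilating_set V E A \<and> (\<forall>v \<in> V - A. set_degree E (A \<union> {v}) > card E)"

end

theory Submission
  imports Defs
begin

text \<open>
  Take a centre with \<open>n = k + 4\<close> legs of length two, that is, a star whose \<open>n\<close> edges are all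
  subdivided, and join two of its middle vertices. The centre and these two middle vertices form a
  triangle, so the graph is not bipartite. The order is \<open>2 * n + 1\<close> and there are \<open>2 * n + 1\<close> edges.

  An independent set avoiding the centre has at most one of the two vertices of each leg, and one
  containing the centre has no middle vertex. Hence the centre together with the leaves is
  the only independent set of size \<open>n + 1\<close>, while the outer edges of the legs are a matching of
  size \<open>n\<close>, which is the most that \<open>2 * n + 1\<close> vertices permit.

  The maximum independent set meets every edge but the extra one, and meets each in one vertex, so
  its degree sum is \<open>2 * n\<close>. This leaves room for one more unit, but all remaining vertices have
  degree at least two: the set is maximal annihilating. It is however expensive, because of the
  centre of degree \<open>n\<close>. Trading the centre for two middle vertices of degree two gives a set of
  \<open>n + 2\<close> vertices with degree sum \<open>n + 4 \<le> 2 * n + 1\<close>, and the annihilation number is at least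
  the size of any annihilating set (\<open>card_le_annihilation_number\<close>).
\<close>

section \<open>Annihilating sets and the annihilation number\<close>

lemma sum_list_take_sorted_le:
  fixes xs :: "nat list"
  assumes "sorted xs" "M \<subseteq># mset xs"
  shows "sum_list (take (size M) xs) \<le> sum_mset M"
  using assms
proof (induction xs arbitrary: M)
  case Nil
  then show ?case by simp
next
  case (Cons x xs)
  show ?case
  proof (cases "M = {#}")
    case True
    then show ?thesis by simp
  next
    case False
    \<comment> \<open>Charge the head of the list to itself if it occurs in \<open>M\<close>, and to any element otherwise.\<close>
    obtain y where y: "y \<in># M" "x \<in># M \<longrightarrow> y = x"
      using False by (metis multiset_nonemptyE)
    then obtain N where M: "M = add_mset y N"
      by (meson multi_member_split)
    have "x \<le> y"
      using y Cons.prems by (metis in_multiset_in_set mset_subset_eqD set_ConsD sorted_simps(2) order_refl)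
    have "N \<subseteq># mset xs"
    proof (cases "x \<in># M")
      case True
      then show ?thesis using M y Cons.prems(2) by simp
    next
      case False
      then have "M \<subseteq># mset xs"
        using Cons.prems(2) by (simp add: subset_mset.inf.absorb_iff1 inter_add_left1 inter_add_right1)
      then show ?thesis
        using M by (metis mset_subset_eq_add_right add_mset_add_single union_commute subset_mset.order_trans)
    qed
    then have "sum_list (take (size N) xs) \<le> sum_mset N"
      using Cons by simp
    then show ?thesis using M \<open>x \<le> y\<close> by simp
  qed
qed

text \<open>The cheapest way to pick \<open>card A\<close> vertices is to take the lowest degrees.\<close>

lemma card_le_annihilation_number:
  assumes "finite V" "annihilating_set V E A"
  shows "card A \<le> annihilation_number V E"
proof -
  have AV: "A \<subseteq> V" and le: "set_degree E A \<le> card E"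
    using assms by (auto simp: annihilating_set_def)
  let ?M = "image_mset (degree E) (mset_set A)"
  have "?M \<subseteq># image_mset (degree E) (mset_set V)"
    using AV assms(1) by (simp add: image_mset_subseteq_mono subset_imp_msubset_mset_set)
  then have "sum_list (take (size ?M) (degree_sequence V E)) \<le> sum_mset ?M"
    by (intro sum_list_take_sorted_le) (auto simp: degree_sequence_def)
  also have "\<dots> = set_degree E A"
    by (simp add: set_degree_def sum_unfold_sum_mset)
  finally have "sum_list (take (card A) (degree_sequence V E)) \<le> card E"
    using le by simp
  moreover have "card A \<le> card V"
    using AV assms(1) by (simp add: card_mono)
  ultimately show ?thesis
    unfolding annihilation_number_def by (intro Max_ge) auto
qed

lemma matching_card_le:
  assumes "simple_graph V E" "matching E M"
  shows "2 * card M \<le> card V"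
proof -
  have M: "\<And>e. e \<in> M \<Longrightarrow> e \<subseteq> V \<and> card e = 2" and fin: "finite V" and dis: "disjoint M"
    using assms by (auto simp: simple_graph_def matching_def)
  have "card (\<Union>M) = (\<Sum>e\<in>M. card e)"
    using M dis
    by (intro card_Union_disjoint)
      (auto simp: disjoint_def pairwise_def disjnt_def intro: card_ge_0_finite)
  also have "\<dots> = 2 * card M"
    using M by simp
  finally show ?thesis
    using M fin card_mono[of V "\<Union>M"] by (metis Union_least)
qed

section \<open>The subdivided star with an extra edge\<close>

text \<open>The centre is \<open>0\<close>, and the \<open>i\<close>-th leg runs through \<open>2 * i + 1\<close> to the leaf \<open>2 * i + 2\<close>.
  The extra edge joins the first two legs.\<close>

definition spider_verts :: "nat \<Rightarrow> nat set" where
  "spider_verts n = {..2 * n}"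

definition spider_edges :: "nat \<Rightarrow> nat set set" where
  "spider_edges n =
    (\<lambda>i. {0, 2 * i + 1}) ` {..<n} \<union> (\<lambda>i. {2 * i + 1, 2 * i + 2}) ` {..<n} \<union> {{1, 3}}"

definition spider_leaves :: "nat \<Rightarrow> nat set" where
  "spider_leaves n = (\<lambda>i. 2 * i + 2) ` {..<n}"

lemma spider_vertex_cases:
  assumes "v \<in> spider_verts n"
  obtains "v = 0" | i where "i < n" "v = 2 * i + 1" | i where "i < n" "v = 2 * i + 2"
proof (cases "v = 0")
  case False
  show ?thesis
  proof (cases "even v")
    case True
    then obtain j where j: "v = 2 * j" by (elim evenE)
    then show ?thesis
      using assms \<open>v \<noteq> 0\<close> that(3)[of "j - 1"] by (auto simp: spider_verts_def)
  next
    case False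
    then obtain j where "v = 2 * j + 1" by (elim oddE)
    then show ?thesis using assms that(2)[of j] by (auto simp: spider_verts_def)
  qed
qed (use that in auto)

lemma spider_edge_cases:
  assumes "e \<in> spider_edges n"
  obtains i where "i < n" "e = {0, 2 * i + 1}"
    | i where "i < n" "e = {2 * i + 1, 2 * i + 2}"
    | "e = {1, 3}"
  using assms unfolding spider_edges_def by blast

lemma spider_spoke: "i < n \<Longrightarrow> {0, 2 * i + 1} \<in> spider_edges n"
  unfolding spider_edges_def by blast

lemma spider_leg: "i < n \<Longrightarrow> {2 * i + 1, 2 * i + 2} \<in> spider_edges n"
  unfolding spider_edges_def by blast

lemma spider_chord: "{1, 3} \<in> spider_edges n"
  unfolding spider_edges_def by blast

lemma spider_verts_card: "card (spider_verts n) = 2 * n + 1"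
  by (simp add: spider_verts_def)

lemma spider_simple:
  assumes "2 \<le> n"
  shows "simple_graph (spider_verts n) (spider_edges n)"
  using assms unfolding simple_graph_def spider_verts_def spider_edges_def by auto

lemma spider_connected: "connected_graph (spider_verts n) (spider_edges n)"
proof -
  let ?R = "adj_rel (spider_edges n)"
  have "sym ?R"
    by (auto simp: sym_def adj_rel_def insert_commute)
  then have sym: "sym (?R\<^sup>*)"
    by (rule sym_rtrancl)
  have mid: "(2 * i + 1, 0) \<in> ?R" if "i < n" for i
    using spider_spoke[OF that] by (simp add: adj_rel_def insert_commute)
  have leaf: "(2 * i + 2, 2 * i + 1) \<in> ?R" if "i < n" for i
    using spider_leg[OF that] by (simp add: adj_rel_def insert_commute)
  have to0: "(v, 0) \<in> ?R\<^sup>*" if "v \<in> spider_verts n" for v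
    using that
  proof (cases rule: spider_vertex_cases)
    case 1
    then show ?thesis by simp
  next
    case (2 i)
    then show ?thesis using mid by blast
  next
    case (3 i)
    then show ?thesis using mid leaf by (meson converse_rtrancl_into_rtrancl rtrancl.rtrancl_refl)
  qed
  then have "(u, v) \<in> ?R\<^sup>*" if "u \<in> spider_verts n" "v \<in> spider_verts n" for u v
    using that sym by (meson rtrancl_trans symD)
  then show ?thesis
    by (auto simp: connected_graph_def spider_verts_def)
qed

lemma spider_not_bipartite:
  assumes "2 \<le> n"
  shows "\<not> bipartite_graph (spider_verts n) (spider_edges n)"
proof
  assume "bipartite_graph (spider_verts n) (spider_edges n)"
  then obtain X Y where XY: "X \<inter> Y = {}"
    and edges: "\<forall>e\<in>spider_edges n. \<exists>x\<in>X. \<exists>y\<in>Y. e = {x, y}"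
    unfolding bipartite_graph_def by (elim exE conjE)
  have opp: "a \<in> X \<and> b \<in> Y \<or> b \<in> X \<and> a \<in> Y" if "{a, b} \<in> spider_edges n" for a b
    using bspec[OF edges that] unfolding doubleton_eq_iff by blast
  have "{0, 1} \<in> spider_edges n" "{0, 3} \<in> spider_edges n"
    using spider_spoke[of 0 n] spider_spoke[of 1 n] assms by (simp_all add: numeral_3_eq_3)
  then show False
    using spider_chord[of n] opp XY by blast
qed

lemma spider_edges_card: "card (spider_edges n) = 2 * n + 1"
proof -
  define A where "A = (\<lambda>i. {0::nat, 2 * i + 1}) ` {..<n}"
  define B where "B = (\<lambda>i. {2 * i + 1, 2 * i + 2::nat}) ` {..<n}"
  have E: "spider_edges n = insert {1, 3} (A \<union> B)"
    by (simp add: spider_edges_def A_def B_def)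
  have "card A = n"
    unfolding A_def by (subst card_image) (auto simp: inj_on_def doubleton_eq_iff)
  moreover have "card B = n"
    unfolding B_def by (subst card_image) (auto simp: inj_on_def doubleton_eq_iff)
  moreover have "A \<inter> B = {}"
    unfolding A_def B_def by (auto simp: doubleton_eq_iff)
  moreover have fin: "finite A" "finite B"
    by (simp_all add: A_def B_def)
  ultimately have "card (A \<union> B) = 2 * n"
    by (simp add: card_Un_disjoint)
  \<comment> \<open>The extra edge is the only one with two odd ends.\<close>
  moreover have "\<exists>x\<in>e. even x" if "e \<in> A \<union> B" for e
    using that unfolding A_def B_def by (elim UnE imageE) simp_all
  from this[of "{1, 3}"] have "{1, 3} \<notin> A \<union> B"
    by auto
  ultimately show ?thesis
    using fin unfolding E by simp
qed

lemma spider_matching_number: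
  assumes "2 \<le> n"
  shows "matching_number (spider_edges n) = n"
  unfolding matching_number_def
proof (rule Max_eqI)
  have le: "card M \<le> n" if "matching (spider_edges n) M" for M
    using matching_card_le[OF spider_simple[OF assms] that] by (simp add: spider_verts_card)
  show "finite {card M |M. matching (spider_edges n) M}"
    by (rule finite_subset[of _ "{..n}"]) (use le in auto)
  show "y \<le> n" if "y \<in> {card M |M. matching (spider_edges n) M}" for y
    using that le by auto
  let ?B = "(\<lambda>i. {2 * i + 1, 2 * i + 2::nat}) ` {..<n}"
  have "card ?B = n"
    by (subst card_image) (auto simp: inj_on_def doubleton_eq_iff)
  moreover have "disjoint ?B"
    by (rule disjoint_family_on_disjoint_image) (simp add: disjoint_family_on_def)
  then have "matching (spider_edges n) ?B"
    unfolding matching_def using spider_leg by blast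
  ultimately show "n \<in> {card M |M. matching (spider_edges n) M}"
    by force
qed

section \<open>Its maximum independent set\<close>

lemma spider_leaves_card: "card (insert 0 (spider_leaves n)) = n + 1"
proof -
  have "card (spider_leaves n) = n"
    unfolding spider_leaves_def by (subst card_image) (auto simp: inj_on_def)
  moreover have "0 \<notin> spider_leaves n" "finite (spider_leaves n)"
    by (auto simp: spider_leaves_def)
  ultimately show ?thesis
    by simp
qed

text \<open>The centre and the leaves are even, whereas every edge has an odd end.\<close>

lemma spider_leaves_independent:
  "independent_set (spider_verts n) (spider_edges n) (insert 0 (spider_leaves n))"
proof -
  have "\<exists>x\<in>e. odd x" if "e \<in> spider_edges n" for e
    using that by (cases rule: spider_edge_cases) simp_all
  moreover have "even v" if "v \<in> insert 0 (spider_leaves n)" for v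
    using that unfolding spider_leaves_def by (elim insertE imageE) simp_all
  moreover have "insert 0 (spider_leaves n) \<subseteq> spider_verts n"
    by (auto simp: spider_leaves_def spider_verts_def)
  ultimately show ?thesis
    unfolding independent_set_def by blast
qed

text \<open>Without the centre, an independent set has at most one vertex on each leg; with it, the
  middle vertices are excluded.\<close>

lemma spider_independent_cases:
  assumes "independent_set (spider_verts n) (spider_edges n) S"
  shows "card S \<le> n \<or> S \<subseteq> insert 0 (spider_leaves n)"
proof (cases "0 \<in> S")
  case True
  have "v \<in> insert 0 (spider_leaves n)" if "v \<in> S" for v
  proof -
    have "v \<in> spider_verts n" using assms that by (auto simp: independent_set_def)
    then show ?thesis
    proof (cases rule: spider_vertex_cases)
      case (2 i)
      then have "{0, v} \<in> spider_edges n" using spider_spoke by simp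
      then show ?thesis using assms True that by (auto simp: independent_set_def)
    qed (auto simp: spider_leaves_def)
  qed
  then show ?thesis by blast
next
  case False
  let ?leg = "\<lambda>v::nat. (v - 1) div 2"
  have leg: "?leg v < n \<and> (v = 2 * ?leg v + 1 \<or> v = 2 * ?leg v + 2)" if "v \<in> S" for v
  proof -
    have "v \<in> spider_verts n" using assms that by (auto simp: independent_set_def)
    then show ?thesis
      by (cases rule: spider_vertex_cases) (use False that in auto)
  qed
  have noedge: "\<not> (2 * i + 1 \<in> S \<and> 2 * i + 2 \<in> S)" if "i < n" for i
    using assms spider_leg[OF that] unfolding independent_set_def by blast
  have "inj_on ?leg S"
    by (rule inj_onI) (metis leg noedge)
  then have "card S \<le> card {..<n}"
    using leg by (intro card_inj_on_le) auto
  then show ?thesis by simp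
qed

lemma spider_independence_number:
  "independence_number (spider_verts n) (spider_edges n) = n + 1"
  unfolding independence_number_def
proof (rule Max_eqI)
  have fin: "finite (insert 0 (spider_leaves n))"
    by (simp add: spider_leaves_def)
  have le: "card S \<le> n + 1" if "independent_set (spider_verts n) (spider_edges n) S" for S
    using spider_independent_cases[OF that] card_mono[OF fin, of S]
    unfolding spider_leaves_card by linarith
  show "finite {card S |S. independent_set (spider_verts n) (spider_edges n) S}"
    by (rule finite_subset[of _ "{..n + 1}"]) (use le in auto)
  show "y \<le> n + 1"
    if "y \<in> {card S |S. independent_set (spider_verts n) (spider_edges n) S}" for y
    using that le by auto
  show "n + 1 \<in> {card S |S. independent_set (spider_verts n) (spider_edges n) S}"
    using spider_leaves_independent[of n] spider_leaves_card[of n, symmetric] by blast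
qed

lemma spider_max_independent_sets:
  "max_independent_sets (spider_verts n) (spider_edges n) \<subseteq> {insert 0 (spider_leaves n)}"
proof
  fix S assume "S \<in> max_independent_sets (spider_verts n) (spider_edges n)"
  then have "independent_set (spider_verts n) (spider_edges n) S" and c: "card S = n + 1"
    by (auto simp: max_independent_sets_def spider_independence_number)
  then have "S \<subseteq> insert 0 (spider_leaves n)"
    using spider_independent_cases by force
  moreover have "finite (insert 0 (spider_leaves n))"
    by (simp add: spider_leaves_def)
  ultimately show "S \<in> {insert 0 (spider_leaves n)}"
    using c card_subset_eq[of "insert 0 (spider_leaves n)" S]
    unfolding spider_leaves_card by simp
qed

section \<open>Its degrees\<close>

lemma card_doubleton: "a \<noteq> b \<Longrightarrow> card {a, b} = 2"
  by simp

lemma spider_finite_edges: "finite (spider_edges n)"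
  by (simp add: spider_edges_def)

lemma spider_degree_centre: "degree (spider_edges n) 0 = n"
proof -
  have "e \<in> (\<lambda>i. {0, 2 * i + 1}) ` {..<n}" if e: "e \<in> spider_edges n" "0 \<in> e" for e
    using e(1)
  proof (cases rule: spider_edge_cases)
    case (1 i)
    then show ?thesis by blast
  qed (use e(2) in simp_all)
  then have "{e \<in> spider_edges n. 0 \<in> e} = (\<lambda>i. {0, 2 * i + 1}) ` {..<n}"
    using spider_spoke by blast
  then show ?thesis
    by (simp add: degree_def card_image inj_on_def doubleton_eq_iff)
qed

lemma spider_degree_leaf:
  assumes "i < n"
  shows "degree (spider_edges n) (2 * i + 2) = 1"
proof -
  have "e = {2 * i + 1, 2 * i + 2}" if e: "e \<in> spider_edges n" "2 * i + 2 \<in> e" for e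
    using e(1)
  proof (cases rule: spider_edge_cases)
    case (1 j)
    then have "2 * i + 2 = 2 * j + 1" using e(2) by simp
    then have False by presburger
    then show ?thesis ..
  next
    case (2 j)
    then have "2 * i + 2 = 2 * j + 1 \<or> 2 * i + 2 = 2 * j + 2" using e(2) by simp
    then have "i = j" by presburger
    then show ?thesis using 2 by simp
  next
    case 3
    then have "2 * i + 2 = 1 \<or> 2 * i + 2 = 3" using e(2) by simp
    then have False by presburger
    then show ?thesis ..
  qed
  then have "{e \<in> spider_edges n. 2 * i + 2 \<in> e} = {{2 * i + 1, 2 * i + 2}}"
    using spider_leg[OF assms] by blast
  then show ?thesis
    by (simp add: degree_def)
qed

lemma spider_degree_middle_ge:
  assumes "i < n"
  shows "degree (spider_edges n) (2 * i + 1) \<ge> 2"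
proof -
  have "{{0, 2 * i + 1}, {2 * i + 1, 2 * i + 2}} \<subseteq> {e \<in> spider_edges n. 2 * i + 1 \<in> e}"
    using spider_spoke[OF assms] spider_leg[OF assms] by blast
  moreover have "{0, 2 * i + 1} \<noteq> {2 * i + 1, 2 * i + 2}"
    by (simp add: doubleton_eq_iff)
  then have "card {{0, 2 * i + 1}, {2 * i + 1, 2 * i + 2}} = 2"
    by (rule card_doubleton)
  moreover have "finite {e \<in> spider_edges n. 2 * i + 1 \<in> e}"
    using spider_finite_edges by (rule finite_subset[rotated]) blast
  ultimately show ?thesis
    unfolding degree_def using card_mono by (metis (no_types, lifting))
qed

lemma spider_degree_middle:
  assumes "i < n" "2 \<le> i"
  shows "degree (spider_edges n) (2 * i + 1) = 2"
proof -
  have "e = {0, 2 * i + 1} \<or> e = {2 * i + 1, 2 * i + 2}"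
    if e: "e \<in> spider_edges n" "2 * i + 1 \<in> e" for e
  proof -
    show ?thesis
      using e(1)
    proof (cases rule: spider_edge_cases)
      case (1 j)
      then have "i = j" using e(2) by simp
      then show ?thesis using 1 by simp
    next
      case (2 j)
      then have "2 * i + 1 = 2 * j + 1 \<or> 2 * i + 1 = 2 * j + 2" using e(2) by simp
      then have "i = j" by presburger
      then show ?thesis using 2 by simp
    next
      case 3
      then show ?thesis using e(2) assms(2) by simp
    qed
  qed
  then have
    "{e \<in> spider_edges n. 2 * i + 1 \<in> e} = {{0, 2 * i + 1}, {2 * i + 1, 2 * i + 2}}"
    using spider_spoke[OF assms(1)] spider_leg[OF assms(1)] by blast
  moreover have "{0, 2 * i + 1} \<noteq> {2 * i + 1, 2 * i + 2}"
    by (simp add: doubleton_eq_iff)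
  then have "card {{0, 2 * i + 1}, {2 * i + 1, 2 * i + 2}} = 2"
    by (rule card_doubleton)
  ultimately show ?thesis
    unfolding degree_def by simp
qed

lemma spider_leaves_set_degree: "set_degree (spider_edges n) (spider_leaves n) = n"
proof -
  have "set_degree (spider_edges n) (spider_leaves n)
      = (\<Sum>i<n. degree (spider_edges n) (2 * i + 2))"
    unfolding set_degree_def spider_leaves_def by (subst sum.reindex) (auto simp: inj_on_def)
  also have "\<dots> = n"
    by (simp add: spider_degree_leaf[simplified])
  finally show ?thesis .
qed

lemma spider_maximal_annihilating:
  "maximal_annihilating_set (spider_verts n) (spider_edges n) (insert 0 (spider_leaves n))"
proof -
  let ?S = "insert 0 (spider_leaves n)"
  have fin: "finite ?S"
    by (simp add: spider_leaves_def)
  have "0 \<notin> spider_leaves n"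
    by (auto simp: spider_leaves_def)
  then have deg: "set_degree (spider_edges n) ?S = 2 * n"
    using spider_leaves_set_degree[of n] spider_degree_centre[of n] fin
    by (simp add: set_degree_def)
  have "?S \<subseteq> spider_verts n"
    using spider_leaves_independent by (simp add: independent_set_def)
  moreover have "set_degree (spider_edges n) (?S \<union> {v}) > card (spider_edges n)"
    if v: "v \<in> spider_verts n - ?S" for v
  proof -
    have "v \<in> spider_verts n" using v by simp
    then have "degree (spider_edges n) v \<ge> 2"
      by (cases rule: spider_vertex_cases)
        (use v spider_degree_middle_ge in \<open>auto simp: spider_leaves_def\<close>)
    moreover have "set_degree (spider_edges n) (?S \<union> {v})
        = degree (spider_edges n) v + set_degree (spider_edges n) ?S"
      using v fin sum.insert[of ?S v "degree (spider_edges n)"] by (simp add: set_degree_def)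
    ultimately show ?thesis
      using deg by (simp add: spider_edges_card)
  qed
  ultimately show ?thesis
    using deg by (simp add: maximal_annihilating_set_def annihilating_set_def spider_edges_card)
qed

text \<open>The middle vertices \<open>5\<close> and \<open>7\<close> of the third and fourth leg do not lie on the extra edge.\<close>

lemma spider_annihilation_number_ge:
  assumes "4 \<le> n"
  shows "n + 2 \<le> annihilation_number (spider_verts n) (spider_edges n)"
proof -
  let ?A = "insert 5 (insert 7 (spider_leaves n))"
  have fin: "finite (spider_leaves n)"
    by (simp add: spider_leaves_def)
  have new: "5 \<notin> insert 7 (spider_leaves n)" "7 \<notin> spider_leaves n"
    unfolding spider_leaves_def by (auto; presburger)+
  have "0 \<notin> spider_leaves n"
    by (auto simp: spider_leaves_def)
  then have card: "card ?A = n + 2"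
    using fin new spider_leaves_card[of n] by simp
  have "degree (spider_edges n) 5 = 2" "degree (spider_edges n) 7 = 2"
    using spider_degree_middle[of 2 n] spider_degree_middle[of 3 n] assms by simp_all
  then have "set_degree (spider_edges n) ?A = n + 4"
    using fin new spider_leaves_set_degree[of n] by (simp add: set_degree_def)
  moreover have "?A \<subseteq> spider_verts n"
    using assms by (auto simp: spider_leaves_def spider_verts_def)
  ultimately have "annihilating_set (spider_verts n) (spider_edges n) ?A"
    using assms by (simp add: annihilating_set_def spider_edges_card)
  then show ?thesis
    using card card_le_annihilation_number[of "spider_verts n"]
    by (metis finite_atMost spider_verts_def)
qed

theorem theorem5p4:
  fixes k :: nat
  shows "\<exists>(V :: nat set) (E :: nat set set).
    simple_graph V E \<and> connected_graph V E \<and> \<not> bipartite_graph V E \<and>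
    konig_egervary V E \<and> card V = 2 * k + 9 \<and>
    int (annihilation_number V E) > \<lceil>real (card V) / 2\<rceil> \<and>
    \<lceil>real (card V) / 2\<rceil> = int (independence_number V E) \<and>
    (\<forall>S \<in> max_independent_sets V E. maximal_annihilating_set V E S)"
proof -
  define n where "n = k + 4"
  have n: "4 \<le> n" "2 \<le> n" by (simp_all add: n_def)
  let ?V = "spider_verts n" and ?E = "spider_edges n"
  have half: "\<lceil>real (card ?V) / 2\<rceil> = int (n + 1)"
    unfolding spider_verts_card by (rule ceiling_unique) auto
  have "konig_egervary ?V ?E"
    using n by (simp add: konig_egervary_def spider_independence_number spider_matching_number
        spider_verts_card)
  moreover have "card ?V = 2 * k + 9"
    by (simp add: spider_verts_card n_def)
  moreover have "int (annihilation_number ?V ?E) > \<lceil>real (card ?V) / 2\<rceil>"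
    using spider_annihilation_number_ge[OF n(1)] unfolding half by linarith
  moreover have "\<lceil>real (card ?V) / 2\<rceil> = int (independence_number ?V ?E)"
    unfolding half spider_independence_number ..
  moreover have "\<forall>S \<in> max_independent_sets ?V ?E. maximal_annihilating_set ?V ?E S"
    using spider_max_independent_sets[of n] spider_maximal_annihilating[of n] by auto
  ultimately show ?thesis
    using spider_simple[OF n(2)] spider_connected spider_not_bipartite[OF n(2)] by blast
qed

end
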